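(* Let $n\ge1$ and $0\le r\le n$ be integers, and let $B\subseteq[n]\times[n]$ be a set with the North-East Property. Then, for every prime power $q$, the number of $n\times n$ matrices over $\mathbf F_q$ of rank $r$ whose support is contained in $B$ is $$\mathrm{mat}_q(n,\overline B,r)=(q-1)^r\,q^{\#B-r}\,R_r^{(\mathrm{NE})}(B,q^{-1}).$$
   Context: $[n]=\{1,\dots,n\}$. Positions in $[n]\times[n]$ are indexed in matrix coordinates: $(i,j)$ is row $i$ (rows numbered from top/north to bottom/south), column $j$ (columns numbered from left/west to right/east). The support of a matrix is the set of positions of its nonzero entries. For $S\subseteq[n]\times[n]$, $\overline S=([n]\times[n])\setminus S$ and $\mathrm{mat}_q(n,S,r)$ is the number of $n\times n$ matrices over the field $\mathbf F_q$ with $q$ elements of rank $r$ with support contained in $\overline S$. A set $B\subseteq[n]\times[n]$ has the North-East (NE) Property if for all $i,i',j,j'\in[n]$ with $i'<i$ and $j<j'$: if $(i,j),(i',j),(i,j')$ are in $B$, then $(i',j')$ is in $B$. A placement $C$ of $r$ non-attacking rooks on $B$ is a set of $r$ positions of $B$, no two in the same row or column. The NE-inversion number $\mathrm{inv}_{\mathrm{NE}}(C,B)$ is the number of elements of $B$ that are not occupied by a rook of $C$ and are not directly north of (in the same column as) or directly east of (in the same row as) any rook of $C$. Finally $R_r^{(\mathrm{NE})}(B,q)=\sum_C q^{\mathrm{inv}_{\mathrm{NE}}(C,B)}$, the sum being over all placements $C$ of $r$ non-attacking rooks on $B$. *)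

theory Defs
  imports "HOL-Library.Cardinality" "Jordan_Normal_Form.DL_Rank"
begin

text \<open>
  Positions are pairs (row, column) of indices in {1..n}, rows being numbered from north to south
  and columns from west to east. Entries of the library's matrices are indexed from 0, so position
  (i + 1, j + 1) carries the entry \<open>A $$ (i, j)\<close>.
\<close>

definition positions :: "nat \<Rightarrow> (nat \<times> nat) set" where
  "positions n = {1..n} \<times> {1..n}"

definition mat_support :: "'a::zero mat \<Rightarrow> (nat \<times> nat) set" where
  "mat_support A = {(i + 1, j + 1) | i j. i < dim_row A \<and> j < dim_col A \<and> A $$ (i, j) \<noteq> 0}"

text \<open>
  The number of n by n matrices of rank r whose support avoids S. The finite field with q elements
  is given as a type of cardinality q, so \<open>TYPE('a)\<close> takes the place of the subscript q.
\<close>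

definition mat_count :: "'a::{field,finite} itself \<Rightarrow> nat \<Rightarrow> (nat \<times> nat) set \<Rightarrow> nat \<Rightarrow> nat" where
  "mat_count _ n S r =
     card {A :: 'a mat. A \<in> carrier_mat n n \<and> vec_space.rank n A = r \<and>
                        mat_support A \<subseteq> positions n - S}"

definition NE_property :: "nat \<Rightarrow> (nat \<times> nat) set \<Rightarrow> bool" where
  "NE_property n B \<longleftrightarrow>
     (\<forall>i\<in>{1..n}. \<forall>i'\<in>{1..n}. \<forall>j\<in>{1..n}. \<forall>j'\<in>{1..n}.
        i' < i \<longrightarrow> j < j' \<longrightarrow> (i, j) \<in> B \<longrightarrow> (i', j) \<in> B \<longrightarrow> (i, j') \<in> B \<longrightarrow> (i', j') \<in> B)"

definition rook_placements :: "nat \<Rightarrow> (nat \<times> nat) set \<Rightarrow> (nat \<times> nat) set set" where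
  "rook_placements r B =
     {C. C \<subseteq> B \<and> finite C \<and> card C = r \<and>
         (\<forall>p\<in>C. \<forall>p'\<in>C. p \<noteq> p' \<longrightarrow> fst p \<noteq> fst p' \<and> snd p \<noteq> snd p')}"

definition inv_NE :: "(nat \<times> nat) set \<Rightarrow> (nat \<times> nat) set \<Rightarrow> nat" where
  "inv_NE C B =
     card {(i, j) \<in> B. (i, j) \<notin> C \<and>
                       \<not> (\<exists>k. (k, j) \<in> C \<and> i < k) \<and>
                       \<not> (\<exists>l. (i, l) \<in> C \<and> l < j)}"

definition R_NE :: "nat \<Rightarrow> (nat \<times> nat) set \<Rightarrow> 'b::comm_semiring_1 \<Rightarrow> 'b" where
  "R_NE r B x = (\<Sum>C\<in>rook_placements r B. x ^ inv_NE C B)"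

end

theory Submission
  imports Defs
begin

text \<open>
  Both sides satisfy the same recursion, obtained by looking at the leftmost column \<open>j\<close> that
  meets \<open>B\<close>.

  On the matrix side, either column \<open>j\<close> of \<open>A\<close> vanishes, and \<open>A\<close> is supported in \<open>B\<close> with that
  column deleted, or column \<open>j\<close> has a southernmost nonzero entry, at \<open>(i, j)\<close> say. Taking this
  entry as the pivot of one step of Gaussian elimination clears row \<open>i\<close> and column \<open>j\<close> and lowers
  the rank by one (\<open>rank_eliminate\<close>). The entry at a position \<open>(a, b)\<close> outside that row and column
  changes only if \<open>(a, j)\<close> and \<open>(i, b)\<close> carry nonzero entries; then \<open>a < i\<close> because the pivot is southernmost and \<open>j < b\<close>
  because column \<open>j\<close> is leftmost, so \<open>(a, b)\<close> lies in \<open>B\<close>. This is the only use of the North-East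
  property: it keeps the support inside \<open>B\<close> both under elimination and when elimination is undone.
  Hence \<open>A\<close> corresponds to an arbitrary matrix of rank one less on \<open>B\<close> without row \<open>i\<close> and
  column \<open>j\<close>, together with a nonzero pivot and arbitrary entries at the positions of \<open>B\<close> north
  and east of the pivot (\<open>card_pivot_mats\<close>).

  On the rook side, weight a placement \<open>C\<close> by \<open>q\<close> to the number of unoccupied positions of \<open>B\<close>
  lying north or east of some rook. Either \<open>C\<close> has no rook in column \<open>j\<close>, or it has one at some
  \<open>(i, j)\<close>; this rook contributes exactly the positions north and east of \<open>(i, j)\<close>, and the others
  form a placement on \<open>B\<close> without row \<open>i\<close> and column \<open>j\<close> (\<open>attack_sum_Suc\<close>).

  Induction on the size of \<open>B\<close> shows that the number of matrices is \<open>(q - 1) ^ r\<close> times the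
  weighted sum of placements (\<open>card_supported_mats\<close>). Finally \<open>B\<close> consists of the \<open>r\<close> rooks, the
  positions counted by \<open>inv_NE\<close> and the positions counted by the weight, which turns the
  weighted sum into \<open>q\<close> to the power \<open>card B - r\<close> times the rook polynomial at \<open>1 / q\<close>.
\<close>

section \<open>Rank under elimination\<close>

definition eliminate :: "nat \<Rightarrow> nat \<Rightarrow> 'a::field mat \<Rightarrow> 'a mat" where
  "eliminate i j A = mat (dim_row A) (dim_col A) (\<lambda>(a, b). A $$ (a, b) - A $$ (a, j) * A $$ (i, b) / A $$ (i, j))"

lemma eliminate_carrier: "A \<in> carrier_mat n m \<Longrightarrow> eliminate i j A \<in> carrier_mat n m"
  by (auto simp: eliminate_def)

text \<open>
  Every column of \<open>A\<close> is a multiple of the pivot column \<open>u\<close> plus the corresponding column of the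
  eliminated matrix \<open>E\<close>, so the column space of \<open>A\<close> is spanned by \<open>u\<close> and the column space of
  \<open>E\<close>. The latter does not contain \<open>u\<close>, since row \<open>i\<close> of \<open>E\<close> is zero and \<open>u $ i\<close> is not.
\<close>

lemma (in vec_space) rank_eliminate:
  assumes A: "A \<in> carrier_mat n m" and i: "i < n" and j: "j < m" and p: "A $$ (i, j) \<noteq> 0"
  shows "rank A = Suc (rank (eliminate i j A))"
proof -
  define E where "E = eliminate i j A"
  define u where "u = col A j"
  have E: "E \<in> carrier_mat n m" unfolding E_def using A by (rule eliminate_carrier)
  have u: "u \<in> carrier_vec n" using A by (auto simp: u_def)
  have ui: "u $ i \<noteq> 0" using A i j p by (auto simp: u_def)
  have colsA: "set (cols A) \<subseteq> carrier_vec n" and colsE: "set (cols E) \<subseteq> carrier_vec n"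
    using A E cols_dim by blast+
  have sub: "insert u (set (cols E)) \<subseteq> carrier_vec n" using u colsE by auto
  have Acol: "set (cols A) = col A ` {..<m}" and Ecol: "set (cols E) = col E ` {..<m}"
    using A E by (auto simp: cols_def)
  have split: "col A k = (A $$ (i, k) / A $$ (i, j)) \<cdot>\<^sub>v u + col E k" if "k < m" for k
    by (rule eq_vecI) (use A E that i j in \<open>auto simp: E_def eliminate_def u_def\<close>)
  have uA: "u \<in> set (cols A)" using Acol j by (auto simp: u_def)
  have spanE_i: "w $ i = 0" if "w \<in> span (set (cols E))" for w
  proof -
    from that col_space_eq[OF E] obtain x where x: "x \<in> carrier_vec m" "w = E *\<^sub>v x"
      using E by (auto simp: col_space_def)
    have "row E i = 0\<^sub>v m"
      by (rule eq_vecI) (use A E i j p in \<open>auto simp: E_def eliminate_def\<close>)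
    then show ?thesis using x i E by (auto simp: scalar_prod_def)
  qed
  have unotin: "u \<notin> span (set (cols E))" using spanE_i ui by blast
  have uE: "u \<notin> set (cols E)" using unotin in_own_span[OF colsE] by blast
  have spans: "span (set (cols A)) = span (insert u (set (cols E)))"
  proof (rule antisym)
    have uin: "u \<in> span (insert u (set (cols E)))" using in_own_span[OF sub] by auto
    have "col A k \<in> span (insert u (set (cols E)))" if "k < m" for k
    proof -
      have "col E k \<in> span (insert u (set (cols E)))"
        using in_own_span[OF sub] Ecol that by auto
      then show ?thesis unfolding split[OF that]
        by (intro span_add1[OF sub] smult_in_span[OF sub] uin)
    qed
    then show "span (set (cols A)) \<subseteq> span (insert u (set (cols E)))"
      using Acol by (intro span_is_subset span_is_submodule sub) auto
    have uin': "u \<in> span (set (cols A))" using in_own_span[OF colsA] uA by auto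
    have "col E k \<in> span (set (cols A))" if "k < m" for k
    proof -
      have eq: "col E k = (- (A $$ (i, k) / A $$ (i, j))) \<cdot>\<^sub>v u + col A k"
        by (rule eq_vecI) (use A E that i j in \<open>auto simp: E_def eliminate_def u_def\<close>)
      have "col A k \<in> span (set (cols A))"
        using in_own_span[OF colsA] Acol that by auto
      then show ?thesis unfolding eq
        by (intro span_add1[OF colsA] smult_in_span[OF colsA] uin')
    qed
    then show "span (insert u (set (cols E))) \<subseteq> span (set (cols A))"
      using Ecol uin' by (intro span_is_subset span_is_submodule colsA) auto
  qed
  \<comment> \<open>A basis of the column space of \<open>E\<close>, chosen among its columns, becomes one for \<open>A\<close> by adding \<open>u\<close>.\<close>
  obtain S where S: "finite S" "maximal S (\<lambda>T. T \<subseteq> set (cols E) \<and> lin_indpt T)"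
    using maximal_exists_superset[of "set (cols E)" "\<lambda>T. T \<subseteq> set (cols E) \<and> lin_indpt T" "{}"]
    by (auto simp: finite_lin_indpt2)
  have Ssub: "S \<subseteq> set (cols E)" and Sli: "lin_indpt S" using S(2) by (auto simp: maximal_def)
  have uS: "u \<notin> S" using Ssub uE by blast
  have "u \<notin> span S" using span_is_monotone[OF Ssub] unotin by blast
  then have ins: "lin_indpt (insert u S)"
    using lin_dep_iff_in_span[of S u] Ssub colsE Sli uS u by auto
  have "maximal (insert u S) (\<lambda>T. T \<subseteq> insert u (set (cols E)) \<and> lin_indpt T)"
    unfolding maximal_def
  proof (intro conjI allI impI)
    show "insert u S \<subseteq> insert u (set (cols E))" using Ssub by blast
    show "lin_indpt (insert u S)" by (rule ins)
    fix T assume T: "insert u S \<subseteq> T \<and> T \<subseteq> insert u (set (cols E)) \<and> lin_indpt T"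
    then have "lin_indpt (T - {u})" using supset_ld_is_ld[of "T - {u}" T] by blast
    moreover have "S \<subseteq> T - {u}" "T - {u} \<subseteq> set (cols E)" using T uS by auto
    ultimately have "S = T - {u}" using S(2) unfolding maximal_def by metis
    then show "T = insert u S" using T by auto
  qed
  from dim_span[OF _ _ this] have "rank A = card (insert u S)"
    unfolding rank_def spans using sub by simp
  moreover have "rank E = card S" by (rule rank_card_indpt[OF E S(2)])
  ultimately show ?thesis using uS S(1) by (simp add: E_def)
qed


lemma rank_eq_0_iff:
  assumes A: "A \<in> carrier_mat n m"
  shows "vec_space.rank n A = 0 \<longleftrightarrow> A = 0\<^sub>m n m"
proof
  assume r: "vec_space.rank n A = 0"
  show "A = 0\<^sub>m n m"
  proof (rule eq_matI)
    fix i j assume "i < dim_row (0\<^sub>m n m)" "j < dim_col (0\<^sub>m n m)"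
    then show "A $$ (i, j) = 0\<^sub>m n m $$ (i, j)"
      using vec_space.rank_eliminate[OF A, of i j] r by fastforce
  qed (use A in auto)
qed (simp add: vec_space.rank_0I)

section \<open>Counting matrices by the pivot in the leftmost column\<close>

definition supported_mats :: "nat \<Rightarrow> (nat \<times> nat) set \<Rightarrow> nat \<Rightarrow> 'a::field mat set" where
  "supported_mats n B r = {A \<in> carrier_mat n n. vec_space.rank n A = r \<and> mat_support A \<subseteq> B}"

text \<open>
  The North-East property with unbounded indices. For \<open>B\<close> inside the n by n square it is the same
  condition, and without a reference to \<open>n\<close> it visibly survives deletion of rows and columns.
\<close>

definition NE_closed :: "(nat \<times> nat) set \<Rightarrow> bool" where
  "NE_closed B \<longleftrightarrow> (\<forall>i i' j j'. i' < i \<longrightarrow> j < j' \<longrightarrow>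
     (i, j) \<in> B \<longrightarrow> (i', j) \<in> B \<longrightarrow> (i, j') \<in> B \<longrightarrow> (i', j') \<in> B)"

definition delete_column :: "nat \<Rightarrow> (nat \<times> nat) set \<Rightarrow> (nat \<times> nat) set" where
  "delete_column j B = {(a, b) \<in> B. b \<noteq> j}"

definition delete_cross :: "nat \<Rightarrow> nat \<Rightarrow> (nat \<times> nat) set \<Rightarrow> (nat \<times> nat) set" where
  "delete_cross i j B = {(a, b) \<in> B. a \<noteq> i \<and> b \<noteq> j}"

definition arms :: "nat \<Rightarrow> nat \<Rightarrow> (nat \<times> nat) set \<Rightarrow> (nat \<times> nat) set" where
  "arms i j B = {(a, b) \<in> B. (a < i \<and> b = j) \<or> (a = i \<and> j < b)}"

definition leftmost_column :: "nat \<Rightarrow> (nat \<times> nat) set \<Rightarrow> bool" where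
  "leftmost_column j B \<longleftrightarrow> (\<forall>p\<in>B. j \<le> snd p)"

lemma finite_positions: "finite (positions n)"
  by (simp add: positions_def)

lemma mat_support_subset_iff:
  assumes "A \<in> carrier_mat n m"
  shows "mat_support A \<subseteq> B \<longleftrightarrow> (\<forall>a<n. \<forall>b<m. A $$ (a, b) \<noteq> 0 \<longrightarrow> (Suc a, Suc b) \<in> B)"
  using assms by (auto simp: mat_support_def)

lemma supported_mats_iff:
  "A \<in> supported_mats n B r \<longleftrightarrow> A \<in> carrier_mat n n \<and> vec_space.rank n A = r \<and>
     (\<forall>a<n. \<forall>b<n. A $$ (a, b) \<noteq> 0 \<longrightarrow> (Suc a, Suc b) \<in> B)"
  unfolding supported_mats_def using mat_support_subset_iff[of A n n B] by auto

lemma finite_carrier_mat: "finite (carrier_mat n m :: 'a::finite mat set)"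
proof -
  have "carrier_mat n m \<subseteq> mat n m ` ({..<n} \<times> {..<m} \<rightarrow>\<^sub>E (UNIV :: 'a set))"
  proof
    fix A :: "'a mat" assume A: "A \<in> carrier_mat n m"
    show "A \<in> mat n m ` ({..<n} \<times> {..<m} \<rightarrow>\<^sub>E UNIV)"
    proof (rule image_eqI)
      show "A = mat n m (restrict (\<lambda>p. A $$ p) ({..<n} \<times> {..<m}))"
        using A by (intro eq_matI) auto
    qed simp
  qed
  moreover have "finite (mat n m ` ({..<n} \<times> {..<m} \<rightarrow>\<^sub>E (UNIV :: 'a set)))"
    by (intro finite_imageI finite_PiE) simp_all
  ultimately show ?thesis by (rule finite_subset)
qed

lemma finite_supported_mats: "finite (supported_mats n B r :: 'a::{field,finite} mat set)"
  by (rule finite_subset[OF _ finite_carrier_mat[of n n]]) (auto simp: supported_mats_def)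

text \<open>
  The pivot \<open>(i, j)\<close>, the southernmost nonzero entry of its column, is given by 0-based matrix
  indices, whereas boards are 1-based; this accounts for the successors below.
\<close>

definition pivot_mats :: "nat \<Rightarrow> (nat \<times> nat) set \<Rightarrow> nat \<Rightarrow> nat \<Rightarrow> nat \<Rightarrow> 'a::field mat set" where
  "pivot_mats n B r i j = {A \<in> supported_mats n B r. A $$ (i, j) \<noteq> 0 \<and> (\<forall>k. i < k \<and> k < n \<longrightarrow> A $$ (k, j) = 0)}"

text \<open>
  The bijection sends \<open>A\<close> to its entries at the pivot and its arms together with the eliminated
  matrix \<open>E\<close>. Its inverse adds to \<open>E\<close> the rank one matrix with the prescribed row \<open>i\<close> and column \<open>j\<close>.
  Both directions preserve supports by \<open>corner\<close>, which is where the North-East property enters.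
\<close>

lemma card_pivot_mats:
  fixes i j n r :: nat and B :: "(nat \<times> nat) set"
  assumes pos: "B \<subseteq> positions n" and ne: "NE_closed B" and left: "leftmost_column (Suc j) B"
    and i: "i < n" and j: "j < n" and ij: "(Suc i, Suc j) \<in> B"
  shows "card (pivot_mats n B (Suc r) i j :: 'a::{field,finite} mat set) =
     (CARD('a) - 1) * CARD('a) ^ card (arms (Suc i) (Suc j) B) *
     card (supported_mats n (delete_cross (Suc i) (Suc j) B) r :: 'a mat set)"
proof -
  define p where "p = (Suc i, Suc j)"
  define Y where "Y = insert p (arms (Suc i) (Suc j) B)"
  define B' where "B' = delete_cross (Suc i) (Suc j) B"
  define F :: "(nat \<times> nat \<Rightarrow> 'a) set" where "F = (\<Pi>\<^sub>E x\<in>Y. if x = p then UNIV - {0} else UNIV)"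
  define read :: "'a mat \<Rightarrow> nat \<times> nat \<Rightarrow> 'a" where
    "read A = restrict (\<lambda>(a, b). A $$ (a - 1, b - 1)) Y" for A
  \<comment> \<open>Off \<open>Y\<close> the elements of \<open>F\<close> are undefined, while the matrix entries to be rebuilt are 0.\<close>
  define ext :: "(nat \<times> nat \<Rightarrow> 'a) \<Rightarrow> nat \<Rightarrow> nat \<Rightarrow> 'a" where
    "ext f a b = (if (Suc a, Suc b) \<in> Y then f (Suc a, Suc b) else 0)" for f a b
  define rebuild :: "(nat \<times> nat \<Rightarrow> 'a) \<times> 'a mat \<Rightarrow> 'a mat" where
    "rebuild = (\<lambda>(f, E). mat n n (\<lambda>(a, b). E $$ (a, b) + ext f a j * ext f i b / ext f i j))"
  have fin: "finite B" by (rule finite_subset[OF pos finite_positions])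
  have YB: "Y \<subseteq> B" using ij by (auto simp: Y_def p_def arms_def)
  have pY: "p \<in> Y" by (simp add: Y_def)
  have parms: "p \<notin> arms (Suc i) (Suc j) B" by (auto simp: p_def arms_def)
  have finarms: "finite (arms (Suc i) (Suc j) B)"
    by (rule finite_subset[OF _ fin]) (auto simp: arms_def)
  have colY: "(Suc a, Suc j) \<in> Y \<longleftrightarrow> (Suc a, Suc j) \<in> B \<and> a \<le> i" for a
    using ij by (auto simp: Y_def p_def arms_def)
  have rowY: "(Suc i, Suc b) \<in> Y \<longleftrightarrow> (Suc i, Suc b) \<in> B \<and> j \<le> b" for b
    using ij by (auto simp: Y_def p_def arms_def)
  \<comment> \<open>The North-East property, extended to the degenerate cases of positions on the cross itself.\<close>
  have corner: "(Suc a, Suc b) \<in> B" if "(Suc a, Suc j) \<in> Y" "(Suc i, Suc b) \<in> Y" for a b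
  proof (cases "a < i \<and> j < b")
    case True
    then show ?thesis using that ij colY rowY
      by (intro ne[unfolded NE_closed_def, rule_format, of "Suc a" "Suc i" "Suc j" "Suc b"]) auto
  next
    case False
    then show ?thesis using that colY rowY by (cases "a = i") auto
  qed
  have "bij_betw (\<lambda>A. (read A, eliminate i j A)) (pivot_mats n B (Suc r) i j) (F \<times> supported_mats n B' r)"
  proof (rule bij_betw_byWitness[where f' = rebuild])
    have entries: "ext (read A) a j = A $$ (a, j)" "ext (read A) i b = A $$ (i, b)"
      if A: "A \<in> pivot_mats n B (Suc r) i j" and ab: "a < n" "b < n" for A a b
    proof -
      have "(Suc a, Suc j) \<in> Y" if "A $$ (a, j) \<noteq> 0"
        using A ab that i j unfolding colY
        by (auto simp: pivot_mats_def supported_mats_iff intro: leI)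
      then show "ext (read A) a j = A $$ (a, j)" by (auto simp: ext_def read_def)
      have "(Suc i, Suc b) \<in> Y" if "A $$ (i, b) \<noteq> 0"
        using A ab that i j left unfolding rowY
        by (force simp: pivot_mats_def supported_mats_iff leftmost_column_def)
      then show "ext (read A) i b = A $$ (i, b)" by (auto simp: ext_def read_def)
    qed
    show "\<forall>A\<in>pivot_mats n B (Suc r) i j. rebuild (read A, eliminate i j A) = A"
    proof
      fix A :: "'a mat" assume A: "A \<in> pivot_mats n B (Suc r) i j"
      then have "A \<in> carrier_mat n n" by (simp add: pivot_mats_def supported_mats_iff)
      then show "rebuild (read A, eliminate i j A) = A"
        using i j by (intro eq_matI) (auto simp: rebuild_def entries[OF A] eliminate_def)
    qed
    show "(\<lambda>A. (read A, eliminate i j A)) ` pivot_mats n B (Suc r) i j \<subseteq> F \<times> supported_mats n B' r"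
    proof (intro image_subsetI SigmaI)
      fix A :: "'a mat" assume A: "A \<in> pivot_mats n B (Suc r) i j"
      then have Ac: "A \<in> carrier_mat n n" and rk: "vec_space.rank n A = Suc r"
        and piv: "A $$ (i, j) \<noteq> 0"
        and supp: "\<And>a b. a < n \<Longrightarrow> b < n \<Longrightarrow> A $$ (a, b) \<noteq> 0 \<Longrightarrow> (Suc a, Suc b) \<in> B"
        by (auto simp: pivot_mats_def supported_mats_iff)
      show "read A \<in> F" using piv by (auto simp: F_def read_def p_def)
      have "(Suc a, Suc b) \<in> B'"
        if ab: "a < n" "b < n" and nz: "eliminate i j A $$ (a, b) \<noteq> 0" for a b
      proof -
        have e: "eliminate i j A $$ (a, b) = A $$ (a, b) - A $$ (a, j) * A $$ (i, b) / A $$ (i, j)"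
          using Ac ab by (auto simp: eliminate_def)
        have "a \<noteq> i" "b \<noteq> j" using nz piv e by auto
        moreover have "(Suc a, Suc b) \<in> B"
        proof (cases "A $$ (a, b) = 0")
          case True
          then have "ext (read A) a j \<noteq> 0" "ext (read A) i b \<noteq> 0"
            using nz e entries[OF A ab] by auto
          then show ?thesis by (intro corner) (auto simp: ext_def split: if_splits)
        qed (use supp ab in auto)
        ultimately show ?thesis by (simp add: B'_def delete_cross_def)
      qed
      then show "eliminate i j A \<in> supported_mats n B' r"
        using vec_space.rank_eliminate[OF Ac i j piv] rk eliminate_carrier[OF Ac]
        by (simp add: supported_mats_iff)
    qed
    have rebuilt: "rebuild (f, E) \<in> pivot_mats n B (Suc r) i j"
        "read (rebuild (f, E)) = f" "eliminate i j (rebuild (f, E)) = E"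
      if f: "f \<in> F" and E: "E \<in> supported_mats n B' r" for f E
    proof -
      let ?A = "rebuild (f, E)"
      have Ec: "E \<in> carrier_mat n n" and Er: "vec_space.rank n E = r"
        and Es: "\<And>a b. a < n \<Longrightarrow> b < n \<Longrightarrow> E $$ (a, b) \<noteq> 0 \<Longrightarrow> (Suc a, Suc b) \<in> B'"
        using E by (auto simp: supported_mats_iff)
      have piv: "ext f i j \<noteq> 0" using PiE_mem[OF f[unfolded F_def] pY] pY
        by (auto simp: ext_def p_def)
      have Ac: "?A \<in> carrier_mat n n" by (simp add: rebuild_def)
      have Aent: "?A $$ (a, b) = E $$ (a, b) + ext f a j * ext f i b / ext f i j"
        if "a < n" "b < n" for a b using that by (simp add: rebuild_def)
      have E0: "E $$ (i, b) = 0" "E $$ (a, j) = 0" if "a < n" "b < n" for a b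
        using Es[of i b] Es[of a j] that i j by (auto simp: B'_def delete_cross_def)
      have Acol: "?A $$ (a, j) = ext f a j" if "a < n" for a
        using Aent[OF that j] E0(2)[OF that j] piv by simp
      have Arow: "?A $$ (i, b) = ext f i b" if "b < n" for b
        using Aent[OF i that] E0(1)[OF i that] piv by simp
      show elim: "eliminate i j ?A = E"
        by (rule eq_matI) (use Ac Ec i j piv in \<open>auto simp: eliminate_def Aent E0\<close>)
      have "vec_space.rank n ?A = Suc r"
        using vec_space.rank_eliminate[OF Ac i j] Er Acol[OF i] piv by (simp add: elim)
      moreover have "(Suc a, Suc b) \<in> B" if ab: "a < n" "b < n" and nz: "?A $$ (a, b) \<noteq> 0" for a b
      proof (cases "E $$ (a, b) = 0")
        case True
        then have "ext f a j \<noteq> 0" "ext f i b \<noteq> 0" using nz Aent[OF ab] by auto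
        then show ?thesis by (intro corner) (auto simp: ext_def split: if_splits)
      qed (use Es ab in \<open>auto simp: B'_def delete_cross_def\<close>)
      moreover have "?A $$ (k, j) = 0" if "i < k" "k < n" for k
        using that by (auto simp: Acol ext_def colY)
      ultimately show "?A \<in> pivot_mats n B (Suc r) i j"
        using Ac Acol[OF i] piv by (simp add: pivot_mats_def supported_mats_iff)
      show "read ?A = f"
      proof
        fix x
        show "read ?A x = f x"
        proof (cases "x \<in> Y")
          case False
          then show ?thesis using f by (cases x) (auto simp: read_def F_def PiE_def extensional_def)
        next
          case True
          obtain a b where x: "x = (Suc a, Suc b)" and ab: "a < n" "b < n"
            using True YB pos by (cases x; cases "fst x"; cases "snd x") (auto simp: positions_def)
          have "a = i \<or> b = j" using True x by (auto simp: Y_def p_def arms_def)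
          then have "?A $$ (a, b) = ext f a b" using Arow Acol ab by auto
          then show ?thesis using True x by (simp add: read_def ext_def)
        qed
      qed
    qed
    show "\<forall>x\<in>F \<times> supported_mats n B' r. (read (rebuild x), eliminate i j (rebuild x)) = x"
      using rebuilt by auto
    show "rebuild ` (F \<times> supported_mats n B' r) \<subseteq> pivot_mats n B (Suc r) i j"
      using rebuilt by auto
  qed
  then have "card (pivot_mats n B (Suc r) i j :: 'a mat set) = card F * card (supported_mats n B' r :: 'a mat set)"
    by (simp add: bij_betw_same_card card_cartesian_product)
  moreover have "card F = (CARD('a) - 1) * CARD('a) ^ card (arms (Suc i) (Suc j) B)"
  proof -
    have "card F = (\<Prod>x\<in>Y. card (if x = p then UNIV - {0} else UNIV :: 'a set))"
      unfolding F_def by (rule card_PiE) (simp add: Y_def finarms)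
    also have "\<dots> = card (UNIV - {0 :: 'a}) * (\<Prod>x\<in>arms (Suc i) (Suc j) B. card (if x = p then UNIV - {0} else UNIV :: 'a set))"
      unfolding Y_def using finarms parms by simp
    also have "(\<Prod>x\<in>arms (Suc i) (Suc j) B. card (if x = p then UNIV - {0} else UNIV :: 'a set))
        = (\<Prod>x\<in>arms (Suc i) (Suc j) B. CARD('a))"
      using parms by (intro prod.cong) auto
    finally show ?thesis by (simp add: card_Diff_singleton)
  qed
  ultimately show ?thesis by (simp add: B'_def)
qed

text \<open>
  A matrix with a nonzero entry in column \<open>j\<close> is a pivot matrix for exactly one row, that of its
  southernmost such entry.
\<close>

lemma card_supported_mats_Suc:
  fixes n j r :: nat and B :: "(nat \<times> nat) set"
  assumes pos: "B \<subseteq> positions n" and ne: "NE_closed B" and left: "leftmost_column j B"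
    and j: "j \<in> {1..n}"
  shows "card (supported_mats n B (Suc r) :: 'a::{field,finite} mat set) =
     card (supported_mats n (delete_column j B) (Suc r) :: 'a mat set) +
     (\<Sum>i | (i, j) \<in> B. (CARD('a) - 1) * CARD('a) ^ card (arms i j B) *
        card (supported_mats n (delete_cross i j B) r :: 'a mat set))"
proof -
  define I where "I = {i. (i, j) \<in> B}"
  define P :: "nat \<Rightarrow> 'a mat set" where "P i = pivot_mats n B (Suc r) (i - 1) (j - 1)" for i
  let ?Z = "supported_mats n (delete_column j B) (Suc r) :: 'a mat set"
  have I: "i \<in> {1..n}" if "i \<in> I" for i using that pos by (auto simp: I_def positions_def)
  have finI: "finite I" using I finite_subset[of I "{1..n}"] by blast
  have finP: "finite (P i)" for i
    unfolding P_def by (rule finite_subset[OF _ finite_supported_mats]) (auto simp: pivot_mats_def)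
  have zero: "A \<in> ?Z \<longleftrightarrow> A \<in> supported_mats n B (Suc r) \<and> (\<forall>k<n. A $$ (k, j - 1) = 0)" for A
  proof (cases j)
    case (Suc j')
    then have "j' < n" using j by auto
    then show ?thesis using Suc by (simp add: supported_mats_iff delete_column_def) blast
  qed (use j in simp)
  have "supported_mats n B (Suc r) = ?Z \<union> (\<Union>i\<in>I. P i)"
  proof (intro equalityI subsetI)
    fix A :: "'a mat" assume A: "A \<in> supported_mats n B (Suc r)"
    show "A \<in> ?Z \<union> (\<Union>i\<in>I. P i)"
    proof (cases "\<forall>k<n. A $$ (k, j - 1) = 0")
      case False
      define K where "K = {k. k < n \<and> A $$ (k, j - 1) \<noteq> 0}"
      have K: "finite K" "K \<noteq> {}" using False by (auto simp: K_def)
      define i where "i = Max K"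
      have i: "i < n" "A $$ (i, j - 1) \<noteq> 0" using Max_in[OF K] by (auto simp: K_def i_def)
      have "A $$ (k, j - 1) = 0" if "i < k" "k < n" for k
      proof (rule ccontr)
        assume "A $$ (k, j - 1) \<noteq> 0"
        then have "k \<le> i" unfolding i_def using that K by (intro Max_ge) (auto simp: K_def)
        then show False using that by simp
      qed
      then have "A \<in> P (Suc i)" using A i by (simp add: P_def pivot_mats_def)
      moreover have "Suc i \<in> I" using A i j
        by (cases j) (auto simp: I_def supported_mats_iff Suc_le_eq)
      ultimately show ?thesis by blast
    qed (use A zero in blast)
  next
    fix A :: "'a mat" assume "A \<in> ?Z \<union> (\<Union>i\<in>I. P i)"
    then show "A \<in> supported_mats n B (Suc r)" by (auto simp: zero P_def pivot_mats_def)
  qed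
  moreover have "?Z \<inter> (\<Union>i\<in>I. P i) = {}"
  proof -
    have False if "A \<in> ?Z" "i \<in> I" "A \<in> P i" for A i
    proof -
      have "i - 1 < n" using I[OF that(2)] by auto
      then show False using that zero by (auto simp: P_def pivot_mats_def)
    qed
    then show ?thesis by blast
  qed
  moreover have "card (\<Union>i\<in>I. P i) = (\<Sum>i\<in>I. card (P i))"
  proof (rule card_UN_disjoint[OF finI], intro ballI finP, intro ballI impI)
    have False if "i \<in> I" "k \<in> I" "i < k" "A \<in> P i" "A \<in> P k" for i k A
    proof -
      have "i - 1 < k - 1" "k - 1 < n" using I[OF that(1)] I[OF that(2)] that(3) by auto
      then show False using that(4,5) by (auto simp: P_def pivot_mats_def)
    qed
    then show "P i \<inter> P k = {}" if "i \<in> I" "k \<in> I" "i \<noteq> k" for i k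
      using that by (meson disjoint_iff linorder_neqE_nat)
  qed
  ultimately have "card (supported_mats n B (Suc r) :: 'a mat set) = card ?Z + (\<Sum>i\<in>I. card (P i))"
    using card_Un_disjoint[of ?Z "\<Union>i\<in>I. P i"] finite_supported_mats[of n "delete_column j B" "Suc r"]
      finI finP by simp
  also have "(\<Sum>i\<in>I. card (P i)) = (\<Sum>i\<in>I. (CARD('a) - 1) * CARD('a) ^ card (arms i j B) *
        card (supported_mats n (delete_cross i j B) r :: 'a mat set))"
  proof (rule sum.cong)
    fix i assume "i \<in> I"
    then have "Suc (i - 1) = i" "i - 1 < n" "(i, j) \<in> B" using I by (force simp: I_def)+
    moreover have "Suc (j - 1) = j" "j - 1 < n" using j by auto
    ultimately show "card (P i) = (CARD('a) - 1) * CARD('a) ^ card (arms i j B) *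
        card (supported_mats n (delete_cross i j B) r :: 'a mat set)"
      using card_pivot_mats[OF pos ne, of "j - 1" "i - 1" r] left by (simp add: P_def)
  qed simp
  finally show ?thesis by (simp add: I_def)
qed

section \<open>Rook placements\<close>

text \<open>
  These positions complement the ones counted by \<open>inv_NE\<close> among the unoccupied positions; they
  correspond to the entries that can be chosen freely in the matrix count.
\<close>

definition attacked :: "(nat \<times> nat) set \<Rightarrow> (nat \<times> nat) set \<Rightarrow> (nat \<times> nat) set" where
  "attacked C B = {(i, j) \<in> B. (i, j) \<notin> C \<and>
     ((\<exists>k. (k, j) \<in> C \<and> i < k) \<or> (\<exists>l. (i, l) \<in> C \<and> l < j))}"

definition attack_sum :: "nat \<Rightarrow> nat \<Rightarrow> (nat \<times> nat) set \<Rightarrow> nat" where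
  "attack_sum q r B = (\<Sum>C\<in>rook_placements r B. q ^ card (attacked C B))"

lemma finite_rook_placements: "finite B \<Longrightarrow> finite (rook_placements r B)"
  by (rule finite_subset[of _ "Pow B"]) (auto simp: rook_placements_def)

lemma card_board_split:
  assumes B: "finite B" and C: "C \<in> rook_placements r B"
  shows "card B = r + inv_NE C B + card (attacked C B)"
proof -
  let ?I = "{(i, j) \<in> B. (i, j) \<notin> C \<and> \<not> (\<exists>k. (k, j) \<in> C \<and> i < k) \<and> \<not> (\<exists>l. (i, l) \<in> C \<and> l < j)}"
  have CB: "C \<subseteq> B" "card C = r" using C by (auto simp: rook_placements_def)
  have "B = C \<union> (?I \<union> attacked C B)" using CB by (auto simp: attacked_def)
  moreover have "finite C" "finite ?I" "finite (attacked C B)"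
    using B CB by (auto intro: finite_subset[OF _ B] simp: attacked_def)
  moreover have "?I \<inter> attacked C B = {}" "C \<inter> (?I \<union> attacked C B) = {}"
    by (auto simp: attacked_def)
  ultimately have "card B = card C + (card ?I + card (attacked C B))"
    using card_Un_disjoint[of C "?I \<union> attacked C B"] card_Un_disjoint[of ?I "attacked C B"] by simp
  then show ?thesis using CB by (simp add: inv_NE_def)
qed

text \<open>
  Without a rook in the leftmost column nothing in that column is attacked, because a rook attacks
  only northward and eastward.
\<close>

lemma attacked_delete_column:
  assumes "leftmost_column j B" and "C \<subseteq> delete_column j B"
  shows "attacked C (delete_column j B) = attacked C B"
proof (intro equalityI subrelI)
  fix a b assume "(a, b) \<in> attacked C B"
  moreover have "j < l" if "(a, l) \<in> C" for a l
    using that assms by (force simp: delete_column_def leftmost_column_def)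
  ultimately show "(a, b) \<in> attacked C (delete_column j B)"
    by (fastforce simp: attacked_def delete_column_def)
qed (auto simp: attacked_def delete_column_def)

text \<open>
  Since column \<open>j\<close> is leftmost and \<open>C\<close> avoids row \<open>i\<close> and column \<open>j\<close>, no rook of \<open>C\<close> attacks a
  position of column \<open>j\<close> (there is none south of it in its column and none to its west). In row \<open>i\<close>
  everything in the board east of \<open>(i, j)\<close> is attacked by the new rook already, so attacks by \<open>C\<close>
  matter only off the cross.
\<close>

lemma attacked_insert:
  assumes left: "leftmost_column j B" and C: "C \<subseteq> delete_cross i j B"
  shows "attacked (insert (i, j) C) B = arms i j B \<union> attacked C (delete_cross i j B)"
proof (intro equalityI subrelI)
  have C': "a \<noteq> i \<and> j < b" if "(a, b) \<in> C" for a b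
    using that assms by (force simp: delete_cross_def leftmost_column_def)
  {
    fix a b assume ab: "(a, b) \<in> attacked (insert (i, j) C) B"
    then have "j \<le> b" using left by (force simp: attacked_def leftmost_column_def)
    consider "a = i" | "a \<noteq> i" "b = j" | "a \<noteq> i" "b \<noteq> j" by blast
    then show "(a, b) \<in> arms i j B \<union> attacked C (delete_cross i j B)"
    proof cases
      case 1
      then show ?thesis using ab \<open>j \<le> b\<close> by (auto simp: attacked_def arms_def)
    next
      case 2
      then show ?thesis using ab C' by (fastforce simp: attacked_def arms_def)
    next
      case 3
      then show ?thesis using ab by (auto simp: attacked_def delete_cross_def)
    qed
  next
    fix a b assume "(a, b) \<in> arms i j B \<union> attacked C (delete_cross i j B)"
    then show "(a, b) \<in> attacked (insert (i, j) C) B"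
      using C' by (auto simp: attacked_def arms_def delete_cross_def)
  }
qed

lemma card_attacked_insert:
  assumes B: "finite B" and left: "leftmost_column j B" and C: "C \<subseteq> delete_cross i j B"
  shows "card (attacked (insert (i, j) C) B) = card (arms i j B) + card (attacked C (delete_cross i j B))"
proof -
  have "finite (arms i j B)" "finite (attacked C (delete_cross i j B))"
    by (auto intro: finite_subset[OF _ B] simp: arms_def attacked_def delete_cross_def)
  moreover have "arms i j B \<inter> attacked C (delete_cross i j B) = {}"
    by (auto simp: arms_def attacked_def delete_cross_def)
  ultimately show ?thesis by (simp add: attacked_insert[OF left C] card_Un_disjoint)
qed

lemma bij_betw_insert_rook:
  assumes ij: "(i, j) \<in> B"
  shows "bij_betw (insert (i, j)) (rook_placements r (delete_cross i j B))
           {C \<in> rook_placements (Suc r) B. (i, j) \<in> C}"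
proof (rule bij_betw_byWitness[where f' = "\<lambda>C. C - {(i, j)}"])
  show "\<forall>C\<in>rook_placements r (delete_cross i j B). insert (i, j) C - {(i, j)} = C"
    by (auto simp: rook_placements_def delete_cross_def)
  show "insert (i, j) ` rook_placements r (delete_cross i j B)
      \<subseteq> {C \<in> rook_placements (Suc r) B. (i, j) \<in> C}"
  proof (intro image_subsetI CollectI conjI)
    fix C assume C: "C \<in> rook_placements r (delete_cross i j B)"
    then have "C \<subseteq> delete_cross i j B" "finite C" "card C = r" by (auto simp: rook_placements_def)
    moreover from this have "(i, j) \<notin> C" by (auto simp: delete_cross_def)
    ultimately show "insert (i, j) C \<in> rook_placements (Suc r) B"
      using C ij by (auto simp: rook_placements_def delete_cross_def)
  qed simp
  show "(\<lambda>C. C - {(i, j)}) ` {C \<in> rook_placements (Suc r) B. (i, j) \<in> C}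
      \<subseteq> rook_placements r (delete_cross i j B)"
  proof (intro image_subsetI)
    fix C assume "C \<in> {C \<in> rook_placements (Suc r) B. (i, j) \<in> C}"
    then have C: "C \<subseteq> B" "finite C" "card C = Suc r" "(i, j) \<in> C"
      and na: "\<And>p p'. p \<in> C \<Longrightarrow> p' \<in> C \<Longrightarrow> p \<noteq> p' \<Longrightarrow> fst p \<noteq> fst p' \<and> snd p \<noteq> snd p'"
      by (auto simp: rook_placements_def)
    have "C - {(i, j)} \<subseteq> delete_cross i j B"
      using C na[of _ "(i, j)"] by (fastforce simp: delete_cross_def)
    then show "C - {(i, j)} \<in> rook_placements r (delete_cross i j B)"
      using C na by (auto simp: rook_placements_def)
  qed
qed (auto simp: insert_absorb)

text \<open>
  This mirrors \<open>card_supported_mats_Suc\<close> term by term: a rook in the leftmost column plays the part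
  of the pivot.
\<close>

lemma attack_sum_Suc:
  assumes B: "finite B" and left: "leftmost_column j B"
  shows "attack_sum q (Suc r) B = attack_sum q (Suc r) (delete_column j B) +
     (\<Sum>i | (i, j) \<in> B. q ^ card (arms i j B) * attack_sum q r (delete_cross i j B))"
proof -
  let ?w = "\<lambda>C. q ^ card (attacked C B)"
  let ?Z = "rook_placements (Suc r) (delete_column j B)"
  let ?P = "\<lambda>i. {C \<in> rook_placements (Suc r) B. (i, j) \<in> C}"
  have finI: "finite {i. (i, j) \<in> B}"
    by (rule finite_subset[of _ "fst ` B"]) (use B in force)+
  have finP: "finite (?P i)" for i using finite_rook_placements[OF B] by simp
  have finZ: "finite ?Z"
    by (intro finite_rook_placements finite_subset[OF _ B]) (auto simp: delete_column_def)
  have split: "rook_placements (Suc r) B = ?Z \<union> (\<Union>i\<in>{i. (i, j) \<in> B}. ?P i)"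
  proof (intro equalityI subsetI)
    fix C assume C: "C \<in> rook_placements (Suc r) B"
    show "C \<in> ?Z \<union> (\<Union>i\<in>{i. (i, j) \<in> B}. ?P i)"
    proof (cases "\<exists>i. (i, j) \<in> C")
      case True
      then show ?thesis using C by (auto simp: rook_placements_def)
    next
      case False
      then have "C \<in> ?Z" using C by (auto simp: rook_placements_def delete_column_def)
      then show ?thesis by blast
    qed
  qed (auto simp: rook_placements_def delete_column_def)
  have disj: "?Z \<inter> (\<Union>i\<in>{i. (i, j) \<in> B}. ?P i) = {}"
    by (auto simp: rook_placements_def delete_column_def)
  have disjP: "?P i \<inter> ?P k = {}" if "i \<noteq> k" for i k
  proof -
    have False if "C \<in> ?P i" "C \<in> ?P k" for C
    proof -
      have "(i, j) \<in> C" "(k, j) \<in> C" using that by auto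
      moreover have "\<forall>p\<in>C. \<forall>p'\<in>C. p \<noteq> p' \<longrightarrow> fst p \<noteq> fst p' \<and> snd p \<noteq> snd p'"
        using that by (simp add: rook_placements_def)
      ultimately show False using \<open>i \<noteq> k\<close> by fastforce
    qed
    then show ?thesis by blast
  qed
  have "attack_sum q (Suc r) B = sum ?w ?Z + sum ?w (\<Union>i\<in>{i. (i, j) \<in> B}. ?P i)"
    unfolding attack_sum_def
    by (rule trans[OF arg_cong[where f = "sum ?w", OF split] sum.union_disjoint])
      (use finZ finI finP disj in auto)
  also have "sum ?w ?Z = attack_sum q (Suc r) (delete_column j B)"
    unfolding attack_sum_def
    by (rule sum.cong) (auto simp: rook_placements_def attacked_delete_column[OF left])
  also have "sum ?w (\<Union>i\<in>{i. (i, j) \<in> B}. ?P i) = (\<Sum>i | (i, j) \<in> B. sum ?w (?P i))"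
    by (rule sum.UNION_disjoint) (use finI finP disjP in auto)
  also have "\<dots> = (\<Sum>i | (i, j) \<in> B. q ^ card (arms i j B) * attack_sum q r (delete_cross i j B))"
  proof (rule sum.cong)
    fix i assume "i \<in> {i. (i, j) \<in> B}"
    then have ij: "(i, j) \<in> B" by simp
    have "sum ?w (?P i) = (\<Sum>C\<in>rook_placements r (delete_cross i j B). ?w (insert (i, j) C))"
      by (rule sum.reindex_bij_betw[OF bij_betw_insert_rook[OF ij], symmetric])
    also have "\<dots> = (\<Sum>C\<in>rook_placements r (delete_cross i j B).
        q ^ card (arms i j B) * q ^ card (attacked C (delete_cross i j B)))"
      by (rule sum.cong)
        (auto simp: rook_placements_def card_attacked_insert[OF B left] power_add)
    finally show "sum ?w (?P i) = q ^ card (arms i j B) * attack_sum q r (delete_cross i j B)"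
      by (simp add: attack_sum_def sum_distrib_left)
  qed simp
  finally show ?thesis .
qed

lemma attack_sum_0: "attack_sum q 0 B = 1"
proof -
  have "rook_placements 0 B = {{}}" by (auto simp: rook_placements_def)
  then show ?thesis by (simp add: attack_sum_def attacked_def)
qed

lemma card_supported_mats_0: "card (supported_mats n B 0 :: 'a::field mat set) = 1"
proof -
  have "supported_mats n B 0 = {0\<^sub>m n n :: 'a mat}"
    by (auto simp: supported_mats_iff rank_eq_0_iff vec_space.rank_0I)
  then show ?thesis by simp
qed

section \<open>The count\<close>

text \<open>
  Both counts obey the same recursion, with an extra factor \<open>q - 1\<close> on the matrix side for each
  pivot; deleting the leftmost nonempty column, or a row and column through one of its positions,
  makes the board smaller and preserves the North-East property.
\<close>

lemma card_supported_mats: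
  assumes "B \<subseteq> positions n" and "NE_closed B"
  shows "card (supported_mats n B r :: 'a::{field,finite} mat set) =
           (CARD('a) - 1) ^ r * attack_sum CARD('a) r B"
  using assms
proof (induction "card B" arbitrary: B r rule: less_induct)
  case less
  have fin: "finite B" using finite_subset[OF less.prems(1) finite_positions] .
  show ?case
  proof (cases r)
    case 0
    then show ?thesis by (simp add: attack_sum_0 card_supported_mats_0)
  next
    case (Suc s)
    show ?thesis
    proof (cases "B = {}")
      case True
      have False if A: "A \<in> supported_mats n B r" for A :: "'a mat"
      proof -
        have "A = 0\<^sub>m n n" using A True by (intro eq_matI) (auto simp: supported_mats_iff)
        then show False using A Suc by (simp add: supported_mats_iff vec_space.rank_0I)
      qed
      then have "supported_mats n B r = ({} :: 'a mat set)" by blast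
      moreover have "rook_placements r B = {}"
        using True Suc by (auto simp: rook_placements_def)
      ultimately show ?thesis by (simp add: attack_sum_def)
    next
      case False
      define j where "j = Min (snd ` B)"
      have jB: "j \<in> snd ` B" unfolding j_def using fin False by (intro Min_in) auto
      have left: "leftmost_column j B"
        using fin by (auto simp: leftmost_column_def j_def)
      have j: "j \<in> {1..n}" using jB less.prems(1) by (auto simp: positions_def)
      have column: "card (supported_mats n (delete_column j B) r :: 'a mat set) =
          (CARD('a) - 1) ^ r * attack_sum CARD('a) r (delete_column j B)"
      proof (rule less.hyps)
        have "delete_column j B \<subset> B" using jB by (auto simp: delete_column_def)
        then show "card (delete_column j B) < card B" by (rule psubset_card_mono[OF fin])
      qed (use less.prems in \<open>fastforce simp: delete_column_def NE_closed_def\<close>)+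
      have cross: "card (supported_mats n (delete_cross i j B) s :: 'a mat set) =
          (CARD('a) - 1) ^ s * attack_sum CARD('a) s (delete_cross i j B)"
        if "(i, j) \<in> B" for i
      proof (rule less.hyps)
        have "delete_cross i j B \<subset> B" using that by (auto simp: delete_cross_def)
        then show "card (delete_cross i j B) < card B" by (rule psubset_card_mono[OF fin])
      qed (use less.prems in \<open>fastforce simp: delete_cross_def NE_closed_def\<close>)+
      show ?thesis
        using card_supported_mats_Suc[OF less.prems left j, of s, where 'a = 'a]
          attack_sum_Suc[OF fin left, of "CARD('a)" s] column cross
        by (simp add: Suc sum_distrib_left distrib_left mult_ac)
    qed
  qed
qed

theorem theorem4p2:
  fixes n r q :: nat and B :: "(nat \<times> nat) set"
  assumes "n \<ge> 1" and "r \<le> n"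
    and "B \<subseteq> positions n" and "NE_property n B"
    and "CARD('a::{field,finite}) = q"
  shows "real (mat_count TYPE('a) n (positions n - B) r) =
           (real q - 1) ^ r * real q powi (int (card B) - int r) * R_NE r B (1 / real q)"
proof -
  have q: "q > 0" using assms(5) by (metis zero_less_card_finite)
  have fin: "finite B" using finite_subset[OF assms(3) finite_positions] .
  have ne: "NE_closed B"
    using assms(3,4) unfolding NE_closed_def NE_property_def positions_def by blast
  have "positions n - (positions n - B) = B" using assms(3) by blast
  then have "mat_count TYPE('a) n (positions n - B) r = card (supported_mats n B r :: 'a mat set)"
    by (simp add: mat_count_def supported_mats_def)
  also have "real \<dots> = (real q - 1) ^ r * (\<Sum>C\<in>rook_placements r B. real q ^ card (attacked C B))"
    using card_supported_mats[OF assms(3) ne, of r, where 'a = 'a] assms(5) q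
    by (simp add: attack_sum_def of_nat_diff)
  also have "(\<Sum>C\<in>rook_placements r B. real q ^ card (attacked C B)) =
      (\<Sum>C\<in>rook_placements r B. real q powi (int (card B) - int r) * (1 / real q) ^ inv_NE C B)"
  proof (rule sum.cong)
    fix C assume "C \<in> rook_placements r B"
    from card_board_split[OF fin this]
    have "int (card B) - int r = int (card (attacked C B) + inv_NE C B)" by simp
    then show "real q ^ card (attacked C B) =
        real q powi (int (card B) - int r) * (1 / real q) ^ inv_NE C B"
      using q by (simp add: power_add power_one_over del: of_nat_add)
  qed simp
  finally show ?thesis by (simp add: R_NE_def sum_distrib_left mult.assoc)
qed

end
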